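(* There are absolute constants $c>0$ and $C>0$ such that for every $N \in \mathbb{N}$, every set $A \subset \mathbb{F}_2^\infty$ of size $|A|=N$, and every $k \in \mathbb{N}$ with $k \geq C N^{1-c}$, the set $A$ is $k$-stable (in $\mathbb{F}_2^\infty$). (That is, every $A \subset \mathbb{F}_2^\infty$ of size $N$ is $O(N^{1-c})$-stable.)
   Context: $\mathbb{N}=\{1,2,3,\dots\}$. $\mathbb{F}_2^\infty$ denotes the direct sum of countably many copies of $\mathbb{F}_2$, regarded as an additive Abelian group. Let $G$ be an Abelian group, $A \subset G$ and $k \in \mathbb{N}$. The set $A$ has the $k$-order property (in $G$) if there are vectors $s=(s_1,\dots,s_k)$ and $t=(t_1,\dots,t_k)$ in $G^k$ such that for all $1 \leq i,j \leq k$ one has $s_i+t_j \in A$ if and only if $i \leq j$. The set $A$ is $k$-stable (in $G$) if it does not have the $k$-order property. *)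

theory Defs
  imports Complex_Main "HOL-Library.Z2" "HOL-Library.Poly_Mapping"
begin

text \<open>The direct sum of countably many copies of \<open>F\<^sub>2\<close>: finitely supported
  functions on the naturals with values in the two-element field \<^typ>\<open>bit\<close>, added
  coordinatewise.\<close>

type_synonym F2_inf = "nat \<Rightarrow>\<^sub>0 bit"

text \<open>The ambient Abelian group \<open>G\<close> is the whole type \<open>'a\<close>. Vectors in \<open>G\<^sup>k\<close> are
  functions of which only the values at \<open>1, \<dots>, k\<close> matter.\<close>

definition k_order_property :: "nat \<Rightarrow> 'a::ab_group_add set \<Rightarrow> bool" where
  "k_order_property k A \<longleftrightarrow>
     (\<exists>s t :: nat \<Rightarrow> 'a. \<forall>i\<in>{1..k}. \<forall>j\<in>{1..k}. s i + t j \<in> A \<longleftrightarrow> i \<le> j)"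

definition k_stable :: "nat \<Rightarrow> 'a::ab_group_add set \<Rightarrow> bool" where
  "k_stable k A \<longleftrightarrow> \<not> k_order_property k A"

end

theory Submission
  imports Defs "HOL-Library.Set_Algebras" "HOL-Library.FuncSet"
begin

text \<open>Cut the half graph \<open>s\<^sub>i + t\<^sub>j\<close> into thirds. For \<open>i\<close> in an earlier third than \<open>j\<close> the sums lie
  in \<open>A\<close>, so Ruzsa's triangle inequality and the Pluennecke inequality (after Petridis) show that
  the middle third \<open>Z\<close> of all the \<open>s\<^sub>i\<close> and \<open>t\<^sub>i\<close> satisfies \<open>|4Z| = O(N\<^sup>8 / k\<^sup>7)\<close>. A linear map to
  \<open>F\<^sub>2\<^sup>n\<close> with \<open>2\<^sup>n \<le> 2|4Z|\<close> that is nonzero on \<open>4Z - {0}\<close> therefore preserves the half graph on the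
  middle third: \<open>s\<^sub>i + t\<^sub>j = s\<^sub>l + t\<^sub>l\<close> never holds for \<open>j < i\<close>, and only for \<open>l = i\<close> if \<open>i = j\<close>.
  The slice rank method, as for tricoloured sum-free sets, bounds the length of such a
  configuration in \<open>F\<^sub>2\<^sup>n\<close> by \<open>3 \<cdot> 2\<^bsup>12n/13\<^esup>\<close>, which gives \<open>k\<^sup>9\<^sup>7 = O(N\<^sup>9\<^sup>6)\<close>.\<close>

section \<open>Sumset inequalities\<close>

text \<open>Fix one representation \<open>d = p - q\<close> for each difference. The pair
  \<open>(p + s, q + s)\<close> then determines \<open>d\<close> as the difference of its entries,
  and hence \<open>p\<close> and \<open>s\<close>, so this map is injective on pairs
  \<open>(d, s)\<close>.\<close>

lemma ruzsa_triangle: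
  fixes P Q S :: "'a::ab_group_add set"
  assumes "finite P" "finite Q" "finite S"
  shows "card {p - q |p q. p \<in> P \<and> q \<in> Q} * card S \<le> card (P + S) * card (Q + S)"
proof -
  define D where "D = {p - q |p q. p \<in> P \<and> q \<in> Q}"
  have "\<forall>d\<in>D. \<exists>pq. fst pq \<in> P \<and> snd pq \<in> Q \<and> d = fst pq - snd pq"
    by (force simp: D_def)
  then obtain r where r: "\<And>d. d \<in> D \<Longrightarrow> fst (r d) \<in> P \<and> snd (r d) \<in> Q \<and> d = fst (r d) - snd (r d)"
    by metis
  have "card (D \<times> S) \<le> card ((P + S) \<times> (Q + S))"
  proof (rule card_inj_on_le)
    show "inj_on (\<lambda>(d, s). (fst (r d) + s, snd (r d) + s)) (D \<times> S)"
    proof (rule inj_onI, clarify)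
      fix d s d' s'
      assume d: "d \<in> D" and d': "d' \<in> D"
        and eq: "fst (r d) + s = fst (r d') + s'" "snd (r d) + s = snd (r d') + s'"
      have "d = (fst (r d) + s) - (snd (r d) + s)" using r[OF d] by simp
      also have "\<dots> = (fst (r d') + s') - (snd (r d') + s')" by (simp only: eq)
      also have "\<dots> = d'" using r[OF d'] by simp
      finally show "d = d' \<and> s = s'" using eq by simp
    qed
    show "(\<lambda>(d, s). (fst (r d) + s, snd (r d) + s)) ` (D \<times> S) \<subseteq> (P + S) \<times> (Q + S)"
      using r by fastforce
    show "finite ((P + S) \<times> (Q + S))"
      using assms by (simp add: finite_set_plus)
  qed
  then show ?thesis by (simp add: D_def card_cartesian_product)
qed

text \<open>Induction on \<open>C\<close>. A new element \<open>c\<close> adds at most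
  \<open>|X + B| - |Y + B|\<close> points on the left, where \<open>Y\<close> collects the
  \<open>x\<close> with \<open>x + c\<close> already in \<open>X + C\<close>. By \<open>eq\<close>
  and \<open>min\<close> this is at most \<open>K * (|X| - |Y|)\<close>, and \<open>X + C\<close>
  gains at least \<open>|X| - |Y|\<close> points.\<close>

lemma petridis:
  fixes X B :: "'a::ab_group_add set" and K :: real
  assumes fin: "finite X" "finite B"
    and eq: "card (X + B) = K * card X"
    and min: "\<And>Y. Y \<subseteq> X \<Longrightarrow> card (Y + B) \<ge> K * card Y"
    and C: "finite C"
  shows "card (X + B + C) \<le> K * card (X + C)"
  using C
proof (induction C rule: finite_induct)
  case empty
  have "M + {} = {}" for M :: "'a set" by (auto simp: set_plus_def)
  then show ?case by simp
next
  case (insert c C)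
  define Y where "Y = {x \<in> X. x + c \<in> X + C}"
  have YX: "Y \<subseteq> X" by (auto simp: Y_def)
  have finY: "finite Y" using fin YX finite_subset by blast
  have trans: "card (M + {c}) = card M" if "finite M" for M
    using card_plus_sing[of M c] .
  have "X + B + insert c C \<subseteq> (X + B + C) \<union> ((X + B + {c}) - (Y + B + {c}))"
  proof
    fix u assume "u \<in> X + B + insert c C"
    then obtain x b e where u: "u = x + b + e" "x \<in> X" "b \<in> B" "e \<in> insert c C"
      by (auto simp: set_plus_def)
    show "u \<in> (X + B + C) \<union> ((X + B + {c}) - (Y + B + {c}))"
    proof (cases "u \<in> Y + B + {c}")
      case True
      then obtain y b' where y: "u = y + b' + c" "y \<in> Y" "b' \<in> B"
        by (auto simp: set_plus_def)
      \<comment> \<open>The definition of \<open>Y\<close> trades \<open>y + c\<close> for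
        \<open>x' + e'\<close> with \<open>e'\<close> in the old \<open>C\<close>, so the translate
        \<open>Y + B + {c}\<close> brings nothing new.\<close>
      then obtain x' e' where x': "y + c = x' + e'" "x' \<in> X" "e' \<in> C"
        by (auto simp: Y_def set_plus_def)
      have "u = (y + c) + b'" by (simp add: y(1) ac_simps)
      also have "\<dots> = x' + b' + e'" unfolding x'(1) by (simp add: ac_simps)
      also have "\<dots> \<in> X + B + C" using x' y by (intro set_plus_intro)
      finally show ?thesis by simp
    next
      case False
      then show ?thesis using u by (auto simp: set_plus_intro)
    qed
  qed
  then have "card (X + B + insert c C) \<le> card ((X + B + C) \<union> ((X + B + {c}) - (Y + B + {c})))"
    using fin finY insert.hyps by (intro card_mono) (simp_all add: finite_set_plus)
  also have "\<dots> \<le> card (X + B + C) + card ((X + B + {c}) - (Y + B + {c}))"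
    by (rule card_Un_le)
  also have "card ((X + B + {c}) - (Y + B + {c})) = card (X + B + {c}) - card (Y + B + {c})"
    using fin finY YX by (intro card_Diff_subset finite_set_plus set_plus_mono2) simp_all
  also have "\<dots> = card (X + B) - card (Y + B)"
    using fin finY by (simp add: trans finite_set_plus)
  finally have 1: "card (X + B + insert c C) \<le> card (X + B + C) + (card (X + B) - card (Y + B))" .
  have "card (Y + B) \<le> card (X + B)"
    using fin YX by (intro card_mono finite_set_plus set_plus_mono2) simp_all
  with 1 have 2: "real (card (X + B + insert c C)) \<le> real (card (X + B + C)) + real (card (X + B)) - real (card (Y + B))"
    by linarith
  have "(X + C) \<union> ((X - Y) + {c}) \<subseteq> X + insert c C"
    by (auto simp: set_plus_def)
  then have "card ((X + C) \<union> ((X - Y) + {c})) \<le> card (X + insert c C)"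
    using fin insert.hyps by (intro card_mono) (simp_all add: finite_set_plus)
  moreover have "(X + C) \<inter> ((X - Y) + {c}) = {}"
  proof -
    have "x + c \<notin> X + C" if "x \<in> X - Y" for x
      using that by (simp add: Y_def)
    moreover have "(X - Y) + {c} = (\<lambda>x. x + c) ` (X - Y)"
      by (auto simp: set_plus_def)
    ultimately show ?thesis by auto
  qed
  then have "card ((X + C) \<union> ((X - Y) + {c})) = card (X + C) + card ((X - Y) + {c})"
    using fin insert.hyps by (intro card_Un_disjoint) (simp_all add: finite_set_plus)
  moreover have "card ((X - Y) + {c}) = card X - card Y"
    using fin trans[of "X - Y"] card_Diff_subset[OF finY YX] by simp
  moreover have "card Y \<le> card X" using fin YX card_mono by blast
  ultimately have 3: "real (card (X + C)) + card X - card Y \<le> card (X + insert c C)"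
    by linarith
  have Kpos: "K \<ge> 0 \<or> X = {}"
    using eq fin by (metis card_gt_0_iff of_nat_0_le_iff of_nat_0_less_iff zero_le_mult_iff not_le)
  have "real (card (X + B + insert c C)) \<le> K * card (X + C) + K * card X - K * card Y"
    using 2 insert.IH min[OF YX] eq by linarith
  also have "\<dots> = K * (real (card (X + C)) + card X - card Y)"
    by (simp add: algebra_simps)
  also have "\<dots> \<le> K * card (X + insert c C)"
  proof (cases "X = {}")
    case True
    then show ?thesis using YX by (simp add: set_plus_def)
  next
    case False
    then show ?thesis using 3 Kpos mult_left_mono by blast
  qed
  finally show ?case .
qed

text \<open>A nonempty \<open>X\<close> inside \<open>A\<close> minimising
  \<open>|X + B| / |X|\<close> satisfies the hypotheses of \<open>petridis\<close>, which then
  strips off one copy of \<open>B\<close> at a time at a cost of \<open>K\<close> each.\<close>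

lemma pluennecke_4:
  fixes A B :: "'a::ab_group_add set" and K :: real
  assumes fin: "finite A" "finite B" and A: "A \<noteq> {}" and K: "card (A + B) \<le> K * card A"
  shows "card (B + B + B + B) \<le> K ^ 4 * card A"
proof -
  define q where "q X = real (card (X + B)) / card X" for X
  have "finite (Pow A - {{}})" "Pow A - {{}} \<noteq> {}" using fin A by auto
  then obtain X where X: "X \<in> Pow A - {{}}" and min: "\<And>Y. Y \<in> Pow A - {{}} \<Longrightarrow> q X \<le> q Y"
    by (metis arg_min_if_finite(1) arg_min_least)
  have XA: "X \<subseteq> A" "X \<noteq> {}" and finX: "finite X" using X fin finite_subset by auto
  then have cX: "card X > 0" by (simp add: card_gt_0_iff)
  have cA: "card A > 0" using A fin by (simp add: card_gt_0_iff)
  have qK: "q X \<le> K" "q X \<ge> 0"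
  proof -
    have "q X \<le> q A" using min A by auto
    also have "\<dots> \<le> K" using K cA by (simp add: q_def divide_le_eq)
    finally show "q X \<le> K" .
  qed (simp add: q_def)
  have step: "card (X + B + C) \<le> K * card (X + C)" if "finite C" for C
  proof -
    have "card (X + B + C) \<le> q X * card (X + C)"
    proof (rule petridis[OF finX fin(2) _ _ that])
      show "card (X + B) = q X * card X" using cX by (simp add: q_def)
      fix Y assume Y: "Y \<subseteq> X"
      show "q X * card Y \<le> card (Y + B)"
      proof (cases "Y = {}")
        case False
        then have "q X \<le> q Y" "card Y > 0"
          using min[of Y] Y XA finite_subset[OF Y finX] by (auto simp: card_gt_0_iff)
        then show ?thesis by (simp add: q_def le_divide_eq)
      qed simp
    qed
    also have "\<dots> \<le> K * card (X + C)" using qK by (intro mult_right_mono) auto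
    finally show ?thesis .
  qed
  have K0: "K \<ge> 0" using qK by simp
  have b2: "finite (B + B)" and b3: "finite (B + B + B)" using fin by (simp_all add: finite_set_plus)
  have 4: "real (card (X + (B + B + B + B))) \<le> K * card (X + (B + B + B))"
    using step[OF b3] by (simp add: ac_simps)
  have 3: "real (card (X + (B + B + B))) \<le> K * card (X + (B + B))"
    using step[OF b2] by (simp add: ac_simps)
  have 2: "real (card (X + (B + B))) \<le> K * card (X + B)"
    using step[OF fin(2)] by (simp add: ac_simps)
  have 1: "real (card (X + B)) \<le> K * card X"
    using qK cX by (simp add: q_def divide_le_eq)
  \<comment> \<open>The fourfold sumset has a translate inside
    \<open>X + (B + B + B + B)\<close>.\<close>
  obtain x where x: "x \<in> X" using XA by auto
  have "card ({x} + (B + B + B + B)) \<le> card (X + (B + B + B + B))"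
    using fin finX x by (intro card_mono finite_set_plus set_plus_mono2) auto
  then have "real (card (B + B + B + B)) \<le> card (X + (B + B + B + B))"
    using card_plus_sing[of "B + B + B + B" x] by (simp add: add.commute)
  also have "\<dots> \<le> K * (K * (K * (K * card X)))"
    using 1 2 3 4 K0 by (meson mult_left_mono order_trans)
  also have "\<dots> \<le> K * (K * (K * (K * card A)))"
    using K0 fin XA by (intro mult_left_mono) (auto simp: card_mono)
  finally show ?thesis by (simp add: power_numeral_reduce mult.assoc)
qed

section \<open>Linear algebra over the field with two elements\<close>

lemma bit_add_self [simp]: "x + x = (0 :: bit)"
  by (cases x) simp_all

lemma sum_sym_diff_bit:
  fixes f :: "'a \<Rightarrow> bit"
  assumes "finite A" "finite B"
  shows "sum f ((A - B) \<union> (B - A)) = sum f A + sum f B"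
proof -
  have "sum f A = sum f (A - B) + sum f (A \<inter> B)" 
    using assms by (metis sum.Int_Diff add.commute)
  moreover have "sum f B = sum f (B - A) + sum f (A \<inter> B)"
    using assms by (metis sum.Int_Diff add.commute Int_commute)
  moreover have "sum f ((A - B) \<union> (B - A)) = sum f (A - B) + sum f (B - A)"
    using assms by (intro sum.union_disjoint) auto
  ultimately show ?thesis
    by (cases "sum f (A - B)"; cases "sum f (A \<inter> B)"; cases "sum f (B - A)") simp_all
qed

text \<open>A vector over the two-element field is encoded by its support.\<close>

lemma kernel_nonempty:
  fixes u :: "'r \<Rightarrow> 'i \<Rightarrow> bit"
  assumes "finite I" "finite R" "card R < card I"
  obtains S where "S \<subseteq> I" "S \<noteq> {}" "\<And>r. r \<in> R \<Longrightarrow> (\<Sum>i\<in>S. u r i) = 0"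
proof -
  define f where "f S = {r \<in> R. (\<Sum>i\<in>S. u r i) = 1}" for S
  \<comment> \<open>There are more vectors than values, so two vectors have the same image; their
    sum, encoded as a symmetric difference, is a nonzero kernel element.\<close>
  have "\<not> inj_on f (Pow I)"
  proof (rule pigeonhole)
    have "card (f ` Pow I) \<le> card (Pow R)"
      using assms by (intro card_mono) (auto simp: f_def)
    also have "\<dots> < card (Pow I)" using assms by (simp add: card_Pow)
    finally show "card (f ` Pow I) < card (Pow I)" .
  qed
  then obtain A B where AB: "A \<subseteq> I" "B \<subseteq> I" "f A = f B" "A \<noteq> B"
    by (auto simp: inj_on_def)
  show thesis
  proof (rule that[of "(A - B) \<union> (B - A)"])
    fix r assume r: "r \<in> R"
    have "(\<Sum>i\<in>A. u r i) = 1 \<longleftrightarrow> (\<Sum>i\<in>B. u r i) = 1"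
      using AB(3) r by (auto simp: f_def)
    then have "(\<Sum>i\<in>A. u r i) = (\<Sum>i\<in>B. u r i)"
      by (cases "\<Sum>i\<in>A. u r i"; cases "\<Sum>i\<in>B. u r i") simp_all
    then show "(\<Sum>i\<in>(A - B) \<union> (B - A). u r i) = 0"
      using AB assms finite_subset by (subst sum_sym_diff_bit) (blast, blast, simp)
  qed (use AB in auto)
qed

text \<open>Take a kernel vector of maximal support \<open>S\<close>. If more than
  \<open>card R\<close> coordinates lay outside \<open>S\<close>, \<open>kernel_nonempty\<close>
  would give a nonzero kernel vector supported there, and adding it would enlarge
  \<open>S\<close>.\<close>

lemma kernel_large_support:
  fixes u :: "'r \<Rightarrow> 'i \<Rightarrow> bit"
  assumes "finite I" "finite R"
  obtains S where "S \<subseteq> I" "card I \<le> card S + card R" "\<And>r. r \<in> R \<Longrightarrow> (\<Sum>i\<in>S. u r i) = 0"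
proof -
  define F where "F = {S. S \<subseteq> I \<and> (\<forall>r\<in>R. (\<Sum>i\<in>S. u r i) = 0)}"
  have "finite F" "{} \<in> F" using assms by (auto simp: F_def)
  then obtain S where S: "S \<in> F" and max: "\<And>T. T \<in> F \<Longrightarrow> card T \<le> card S"
    using obtains_MAX[of F card] by (metis Max_ge empty_iff finite_imageI image_eqI)
  have "card I \<le> card S + card R"
  proof (rule ccontr)
    assume "\<not> ?thesis"
    moreover have SI: "S \<subseteq> I" using S by (simp add: F_def)
    then have fS: "finite S" using assms finite_subset by blast
    moreover have "card (I - S) = card I - card S" using SI fS by (simp add: card_Diff_subset)
    ultimately have "card R < card (I - S)" by linarith
    then obtain W where W: "W \<subseteq> I - S" "W \<noteq> {}" "\<And>r. r \<in> R \<Longrightarrow> (\<Sum>i\<in>W. u r i) = 0"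
      using kernel_nonempty assms by (metis finite_Diff)
    have fW: "finite W" using W assms finite_subset by (metis finite_Diff)
    have un: "sum f (S \<union> W) = sum f S + sum f W" for f :: "'i \<Rightarrow> bit"
      using W fW fS by (intro sum.union_disjoint) auto
    have "S \<union> W \<in> F" using S W un by (auto simp: F_def)
    moreover have "card (S \<union> W) = card S + card W"
      using W fW fS by (intro card_Un_disjoint) auto
    moreover have "card W > 0" using W fW by (simp add: card_gt_0_iff)
    ultimately show False using max by fastforce
  qed
  then show thesis using S that[of S] by (simp add: F_def)
qed

text \<open>A slice rank bound for tensors that are unitriangular in the first two indices: contracting
  the third index with a vector of large support that kills the third family of slices leaves a
  triangular matrix, whose rank is at least the size of that support.\<close>

lemma slice_rank_triangular:
  fixes T :: "'i::linorder \<Rightarrow> 'i \<Rightarrow> 'i \<Rightarrow> bit"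
  assumes fin: "finite I" "finite R"
    and T: "\<And>i j l. \<lbrakk>i \<in> I; j \<in> I; l \<in> I\<rbrakk> \<Longrightarrow> T i j l =
      (\<Sum>r\<in>R. u r i * U r j l) + (\<Sum>r\<in>R. v r j * V r i l) + (\<Sum>r\<in>R. w r l * W r i j)"
    and lower: "\<And>i j l. \<lbrakk>i \<in> I; j \<in> I; l \<in> I; j < i\<rbrakk> \<Longrightarrow> T i j l = 0"
    and diag: "\<And>i l. \<lbrakk>i \<in> I; l \<in> I\<rbrakk> \<Longrightarrow> T i i l = of_bool (i = l)"
  shows "card I \<le> 3 * card R"
proof (rule ccontr)
  assume big: "\<not> card I \<le> 3 * card R"
  obtain S where S: "S \<subseteq> I" "card I \<le> card S + card R" "\<And>r. r \<in> R \<Longrightarrow> (\<Sum>l\<in>S. w r l) = 0"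
    using kernel_large_support[OF fin, of w] by metis
  have fS: "finite S" using S fin finite_subset by blast
  define M where "M i j = (\<Sum>l\<in>S. T i j l)" for i j
  have M: "M i j = (\<Sum>r\<in>R. u r i * (\<Sum>l\<in>S. U r j l)) + (\<Sum>r\<in>R. v r j * (\<Sum>l\<in>S. V r i l))"
    if "i \<in> S" "j \<in> S" for i j
  proof -
    have "M i j = (\<Sum>l\<in>S. (\<Sum>r\<in>R. u r i * U r j l) + (\<Sum>r\<in>R. v r j * V r i l) + (\<Sum>r\<in>R. w r l * W r i j))"
      unfolding M_def using that S by (intro sum.cong T) auto
    also have "\<dots> = (\<Sum>r\<in>R. u r i * (\<Sum>l\<in>S. U r j l)) + (\<Sum>r\<in>R. v r j * (\<Sum>l\<in>S. V r i l))
        + (\<Sum>r\<in>R. (\<Sum>l\<in>S. w r l) * W r i j)"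
      unfolding sum.distrib sum_distrib_left sum_distrib_right by (simp only: sum.swap[of _ R S])
    also have "(\<Sum>r\<in>R. (\<Sum>l\<in>S. w r l) * W r i j) = 0"
      using S(3) by (intro sum.neutral) simp
    finally show ?thesis by simp
  qed
  \<comment> \<open>The contracted matrix \<open>M\<close> is a sum of \<open>2 * card R\<close>
    rank-one terms, fewer than \<open>card S\<close>. Hence some nonzero vector \<open>Z\<close> is
    annihilated by all their column factors.\<close>
  define R' where "R' = R <+> R"
  define h where "h r j = (case r of Inl r \<Rightarrow> (\<Sum>l\<in>S. U r j l) | Inr r \<Rightarrow> v r j)" for r j
  have "finite R'" "card R' < card S"
    using fin big S(2) by (auto simp: R'_def card_Plus)
  then obtain Z where Z: "Z \<subseteq> S" "Z \<noteq> {}" "\<And>r. r \<in> R' \<Longrightarrow> (\<Sum>j\<in>Z. h r j) = 0"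
    using kernel_nonempty[OF fS] by metis
  have fZ: "finite Z" using Z fS finite_subset by blast
  \<comment> \<open>In the row of the largest index of \<open>Z\<close> only the diagonal entry
    survives. It equals 1, although \<open>M\<close> kills \<open>Z\<close>.\<close>
  define i where "i = Max Z"
  have iZ: "i \<in> Z" and imax: "\<And>j. j \<in> Z \<Longrightarrow> j \<le> i" using Z fZ by (auto simp: i_def)
  then have iS: "i \<in> S" using Z by auto
  have "(\<Sum>j\<in>Z. M i j) = (\<Sum>j\<in>Z. (\<Sum>r\<in>R. u r i * (\<Sum>l\<in>S. U r j l)) + (\<Sum>r\<in>R. v r j * (\<Sum>l\<in>S. V r i l)))"
    using iS Z by (intro sum.cong M) auto
  also have "\<dots> = (\<Sum>r\<in>R. u r i * (\<Sum>j\<in>Z. h (Inl r) j)) + (\<Sum>r\<in>R. (\<Sum>j\<in>Z. h (Inr r) j) * (\<Sum>l\<in>S. V r i l))"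
    unfolding sum.distrib h_def sum_distrib_left[of _ _ Z] sum_distrib_right[of _ Z] sum.case
    by (simp only: sum.swap[of _ R Z])
  also have "\<dots> = 0" using Z(3) by (simp add: R'_def InlI InrI)
  finally have "(\<Sum>j\<in>Z. M i j) = 0" .
  moreover have "(\<Sum>j\<in>Z. M i j) = M i i"
  proof -
    have "M i j = 0" if "j \<in> Z - {i}" for j
      unfolding M_def using that S Z iS imax[of j]
      by (intro sum.neutral ballI lower) auto
    then show ?thesis using fZ iZ by (simp add: sum.remove[of Z i])
  qed
  moreover have "M i i = (\<Sum>l\<in>S. of_bool (i = l))"
    unfolding M_def using S iS by (intro sum.cong diag) auto
  moreover have "(\<Sum>l\<in>S. of_bool (i = l)) = (1 :: bit)"
    using iS fS by (simp add: of_bool_def)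
  ultimately show False by simp
qed

section \<open>Slice decomposition of the delta tensor and the count of low-degree monomials\<close>

text \<open>Grouping the choices \<open>g\<close> by the set \<open>A\<close> where they take the
  value \<open>k\<close> splits off the monomial on \<open>A\<close>. The cofactor never uses the
  value \<open>k\<close>, so there \<open>f\<close> may be replaced by \<open>f'\<close>; this is
  later used to make the cofactor visibly independent of one group of variables.\<close>

lemma sum_prod_by_fibre:
  fixes f f' :: "nat \<Rightarrow> nat \<Rightarrow> bit"
  assumes fin: "finite G" "finite P"
    and P: "\<And>g. g \<in> G \<Longrightarrow> {c. c < n \<and> g c = k} \<in> P"
    and f': "\<And>c r. r \<noteq> k \<Longrightarrow> f c r = f' c r"
  shows "(\<Sum>g\<in>G. \<Prod>c<n. f c (g c)) =
    (\<Sum>A\<in>P. (\<Prod>c\<in>A. f c k) *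
      (\<Sum>g\<in>{g\<in>G. {c. c < n \<and> g c = k} = A}. \<Prod>c\<in>{..<n} - A. f' c (g c)))"
proof -
  have "(\<Sum>g\<in>G. \<Prod>c<n. f c (g c)) =
    (\<Sum>A\<in>P. \<Sum>g\<in>{g\<in>G. {c. c < n \<and> g c = k} = A}. \<Prod>c<n. f c (g c))"
    using fin P by (intro sum.group[symmetric]) auto
  also have "\<dots> = (\<Sum>A\<in>P. \<Sum>g\<in>{g\<in>G. {c. c < n \<and> g c = k} = A}.
      (\<Prod>c\<in>A. f c k) * (\<Prod>c\<in>{..<n} - A. f' c (g c)))"
  proof (intro sum.cong refl, clarify)
    fix g assume g: "g \<in> G"
    let ?A = "{c. c < n \<and> g c = k}"
    have "(\<Prod>c<n. f c (g c)) = (\<Prod>c\<in>{..<n} - ?A. f c (g c)) * (\<Prod>c\<in>?A. f c (g c))"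
      by (intro prod.subset_diff) auto
    also have "(\<Prod>c\<in>{..<n} - ?A. f c (g c)) = (\<Prod>c\<in>{..<n} - ?A. f' c (g c))"
      by (intro prod.cong f') auto
    also have "(\<Prod>c\<in>?A. f c (g c)) = (\<Prod>c\<in>?A. f c k)"
      by (intro prod.cong) auto
    finally show "(\<Prod>c<n. f c (g c)) = (\<Prod>c\<in>?A. f c k) * (\<Prod>c\<in>{..<n} - ?A. f' c (g c))"
      by (simp add: mult.commute)
  qed
  finally show ?thesis by (simp only: sum_distrib_left)
qed

text \<open>A square-free monomial is encoded by the set of its variables.\<close>

abbreviation low_degree :: "nat \<Rightarrow> nat set set" where
  "low_degree n \<equiv> {A. A \<subseteq> {..<n} \<and> 3 * card A \<le> n}"

lemma finite_low_degree: "finite (low_degree n)"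
  by (rule finite_subset[of _ "Pow {..<n}"]) auto

text \<open>Every monomial in the expansion of the product has degree at most \<open>n / 3\<close> in at least one
  of the three groups of variables.\<close>

lemma delta_slices:
  "\<exists>U V W. \<forall>x y z :: nat \<Rightarrow> bit. (\<Prod>c<n. 1 + x c + y c + z c) =
      (\<Sum>A\<in>low_degree n. (\<Prod>c\<in>A. x c) * U A y z) +
      (\<Sum>A\<in>low_degree n. (\<Prod>c\<in>A. y c) * V A x z) +
      (\<Sum>A\<in>low_degree n. (\<Prod>c\<in>A. z c) * W A x y)"
proof -
  \<comment> \<open>The four values of \<open>r\<close> index the summands \<open>x c\<close>,
    \<open>y c\<close>, \<open>z c\<close> and 1 of a factor; each \<open>g\<close> in
    \<open>E\<close> below selects one summand from every factor.\<close>
  define F where "F x y z c r = (if r = 0 then x c else if r = 1 then y c else if r = 2 then z c else 1)"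
    for x y z :: "nat \<Rightarrow> bit" and c r :: nat
  define E where "E = PiE {..<n} (\<lambda>_. {..<4::nat})"
  define fib where "fib g r = {c. c < n \<and> g c = r}" for g :: "nat \<Rightarrow> nat" and r
  have finE: "finite E" by (simp add: E_def finite_PiE)
  \<comment> \<open>Each monomial is assigned to the first group of variables in which its degree is
    low, so that none is counted twice.\<close>
  define G0 where "G0 = {g\<in>E. fib g 0 \<in> low_degree n}"
  define G1 where "G1 = {g\<in>E - G0. fib g 1 \<in> low_degree n}"
  define G2 where "G2 = E - G0 - G1"
  have fin: "finite G0" "finite G1" "finite G2" using finE by (auto simp: G0_def G1_def G2_def)
  \<comment> \<open>The three fibres are disjoint in a set of \<open>n\<close> points; if the first
    two have more than \<open>n / 3\<close> points each, the third has fewer.\<close>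
  have G2: "fib g 2 \<in> low_degree n" if "g \<in> G2" for g
  proof -
    have sub: "fib g r \<subseteq> {..<n}" for r by (auto simp: fib_def)
    have "card (fib g 0 \<union> fib g 1 \<union> fib g 2) \<le> card {..<n}"
      using sub by (intro card_mono) auto
    moreover have "card (fib g 0 \<union> fib g 1 \<union> fib g 2) = card (fib g 0) + card (fib g 1) + card (fib g 2)"
      using sub finite_subset[OF sub] by (subst card_Un_disjoint; (subst card_Un_disjoint)?) (auto simp: fib_def)
    ultimately show ?thesis
      using that sub by (auto simp: G0_def G1_def G2_def)
  qed
  define R where "R G x y z r A = (\<Sum>g\<in>{g\<in>G. fib g r = A}. \<Prod>c\<in>{..<n} - A. F x y z c (g c))" for G x y z r A
  show ?thesis
  proof (intro exI allI)
    fix x y z :: "nat \<Rightarrow> bit"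
    have expand: "1 + x c + y c + z c = (\<Sum>r<4. F x y z c r)" for c
    proof -
      have "{..<4::nat} = {0, 1, 2, 3}" by auto
      then show ?thesis by (cases "x c"; cases "y c"; cases "z c") (simp_all add: F_def)
    qed
    have "(\<Prod>c<n. 1 + x c + y c + z c) = (\<Prod>c<n. \<Sum>r\<in>{..<4}. F x y z c r)"
      by (intro prod.cong refl) (simp only: expand)
    also have "\<dots> = (\<Sum>g\<in>E. \<Prod>c<n. F x y z c (g c))"
      unfolding E_def by (rule prod_sum_PiE) auto
    also have "E = G0 \<union> G1 \<union> G2" by (auto simp: G0_def G1_def G2_def)
    also have "(\<Sum>g\<in>G0 \<union> G1 \<union> G2. \<Prod>c<n. F x y z c (g c)) = (\<Sum>g\<in>G0. \<Prod>c<n. F x y z c (g c))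
       + (\<Sum>g\<in>G1. \<Prod>c<n. F x y z c (g c)) + (\<Sum>g\<in>G2. \<Prod>c<n. F x y z c (g c))"
      using fin by (subst sum.union_disjoint; (subst sum.union_disjoint)?) (auto simp: G1_def G2_def)
    \<comment> \<open>Putting the zero function for the variable already split off leaves a cofactor
      depending on the other two only.\<close>
    also have "(\<Sum>g\<in>G0. \<Prod>c<n. F x y z c (g c)) =
        (\<Sum>A\<in>low_degree n. (\<Prod>c\<in>A. F x y z c 0) * R G0 (\<lambda>_. 0) y z 0 A)"
      unfolding R_def fib_def
      by (rule sum_prod_by_fibre[OF fin(1) finite_low_degree]) (auto simp: G0_def fib_def F_def)
    also have "(\<Sum>g\<in>G1. \<Prod>c<n. F x y z c (g c)) =
        (\<Sum>A\<in>low_degree n. (\<Prod>c\<in>A. F x y z c 1) * R G1 x (\<lambda>_. 0) z 1 A)"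
      unfolding R_def fib_def
      by (rule sum_prod_by_fibre[OF fin(2) finite_low_degree]) (auto simp: G1_def fib_def F_def)
    also have "(\<Sum>g\<in>G2. \<Prod>c<n. F x y z c (g c)) =
        (\<Sum>A\<in>low_degree n. (\<Prod>c\<in>A. F x y z c 2) * R G2 x y (\<lambda>_. 0) 2 A)"
      unfolding R_def fib_def
      by (rule sum_prod_by_fibre[OF fin(3) finite_low_degree G2[unfolded fib_def]]) (auto simp: F_def)
    finally show "(\<Prod>c<n. 1 + x c + y c + z c) =
      (\<Sum>A\<in>low_degree n. (\<Prod>c\<in>A. x c) * R G0 (\<lambda>_. 0) y z 0 A) +
      (\<Sum>A\<in>low_degree n. (\<Prod>c\<in>A. y c) * R G1 x (\<lambda>_. 0) z 1 A) +
      (\<Sum>A\<in>low_degree n. (\<Prod>c\<in>A. z c) * R G2 x y (\<lambda>_. 0) 2 A)"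
      by (simp add: F_def)
  qed
qed

text \<open>With \<open>z l = x l + y l\<close>, the product of the factors
  \<open>1 + x + y + z\<close> is the indicator of \<open>x i + y j = x l + y l\<close> in the first
  \<open>n\<close> coordinates. The hypotheses make this tensor unitriangular, and
  \<open>delta_slices\<close> bounds its slice rank.\<close>

lemma triangular_sums_bound:
  fixes x y :: "'i::linorder \<Rightarrow> nat \<Rightarrow> bit"
  assumes fin: "finite I"
    and lower: "\<And>i j l. \<lbrakk>i \<in> I; j \<in> I; l \<in> I; j < i\<rbrakk> \<Longrightarrow> \<exists>c<n. x i c + y j c + x l c + y l c \<noteq> 0"
    and diag: "\<And>i l. \<lbrakk>i \<in> I; l \<in> I; i \<noteq> l\<rbrakk> \<Longrightarrow> \<exists>c<n. x i c + y i c + x l c + y l c \<noteq> 0"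
  shows "card I \<le> 3 * card (low_degree n)"
proof -
  obtain U V W :: "nat set \<Rightarrow> (nat \<Rightarrow> bit) \<Rightarrow> (nat \<Rightarrow> bit) \<Rightarrow> bit" where UVW:
    "\<forall>x y z :: nat \<Rightarrow> bit. (\<Prod>c<n. 1 + x c + y c + z c) =
      (\<Sum>A\<in>low_degree n. (\<Prod>c\<in>A. x c) * U A y z) +
      (\<Sum>A\<in>low_degree n. (\<Prod>c\<in>A. y c) * V A x z) +
      (\<Sum>A\<in>low_degree n. (\<Prod>c\<in>A. z c) * W A x y)"
    using delta_slices[of n] by (elim exE) (erule that)
  define z where "z l c = x l c + y l c" for l c
  define T where "T i j l = (\<Prod>c<n. 1 + x i c + y j c + z l c)" for i j l
  have zero: "T i j l = 0" if nz: "\<exists>c<n. x i c + y j c + x l c + y l c \<noteq> 0" for i j l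
  proof -
    obtain c where c: "c < n" "x i c + y j c + x l c + y l c \<noteq> 0" using nz by blast
    have "1 + x i c + y j c + z l c = 0"
      using c(2) unfolding z_def
      by (cases "x i c"; cases "y j c"; cases "x l c"; cases "y l c") simp_all
    then show ?thesis unfolding T_def using c(1) by (intro prod_zero) auto
  qed
  have one: "T i i i = 1" for i
  proof -
    have "1 + x i c + y i c + z i c = 1" for c
      unfolding z_def by (cases "x i c"; cases "y i c") simp_all
    then show ?thesis by (simp only: T_def prod.neutral_const)
  qed
  show ?thesis
  proof (rule slice_rank_triangular[where T = T and u = "\<lambda>A i. \<Prod>c\<in>A. x i c"
        and v = "\<lambda>A j. \<Prod>c\<in>A. y j c" and w = "\<lambda>A l. \<Prod>c\<in>A. z l c"
        and U = "\<lambda>A j l. U A (y j) (z l)" and V = "\<lambda>A i l. V A (x i) (z l)"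
        and W = "\<lambda>A i j. W A (x i) (y j)"])
    show "T i j l = (\<Sum>A\<in>low_degree n. (\<Prod>c\<in>A. x i c) * U A (y j) (z l))
      + (\<Sum>A\<in>low_degree n. (\<Prod>c\<in>A. y j c) * V A (x i) (z l))
      + (\<Sum>A\<in>low_degree n. (\<Prod>c\<in>A. z l c) * W A (x i) (y j))" for i j l
      unfolding T_def by (rule UVW[rule_format])
    show "T i i l = of_bool (i = l)" if "i \<in> I" "l \<in> I" for i l
      using zero[OF diag[OF that]] one by (cases "i = l") auto
  qed (use fin finite_low_degree zero lower in auto)
qed

text \<open>An exponential moment bound: each low-degree \<open>A\<close> has weight
  \<open>(1/2) ^ card A\<close> at least \<open>u ^ n\<close>, while all subsets together weigh
  \<open>(3/2) ^ n\<close>. Cubing gives the base \<open>27/4\<close>.\<close>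

lemma card_low_degree: "real (card (low_degree n)) ^ 13 \<le> 2 ^ (12 * n)"
proof -
  define u where "u = root 3 (1/2)"
  have u3: "u ^ 3 = 1/2" and u: "0 < u" "u \<le> 1" by (simp_all add: u_def)
  have "card (low_degree n) * u ^ n = (\<Sum>A\<in>low_degree n. u ^ n)" by simp
  also have "\<dots> \<le> (\<Sum>A\<in>low_degree n. (1/2) ^ card A)"
  proof (rule sum_mono)
    fix A assume "A \<in> low_degree n"
    then have "u ^ n \<le> u ^ (3 * card A)" using u by (intro power_decreasing) auto
    then show "u ^ n \<le> (1/2) ^ card A" by (simp add: power_mult u3)
  qed
  also have "\<dots> \<le> (\<Sum>A\<in>Pow {..<n}. (1/2) ^ card A)"
    by (rule sum_mono2) auto
  also have "\<dots> = (3/2) ^ n"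
    using prod_add[of "{..<n}" "\<lambda>_. 1/2 :: real" "\<lambda>_. 1"] by simp
  finally have "(card (low_degree n) * u ^ n) ^ 3 \<le> ((3/2) ^ n) ^ 3"
    using u by (intro power_mono) auto
  then have "real (card (low_degree n)) ^ 3 * (1/2) ^ n \<le> ((27/8) ^ n :: real)"
    by (simp add: power_mult_distrib u3 flip: power_mult)
       (simp add: mult.commute[of n] power_mult u3 power_divide)
  also have "(27/8 :: real) ^ n = (27/4) ^ n * (1/2) ^ n"
    by (simp flip: power_mult_distrib)
  finally have "real (card (low_degree n)) ^ 3 \<le> (27/4) ^ n"
    by (simp del: power_divide)
  then have "(real (card (low_degree n)) ^ 3) ^ 13 \<le> ((27/4) ^ n) ^ 13"
    by (intro power_mono) auto
  also have "\<dots> = ((27/4) ^ 13) ^ n" by (simp add: mult.commute flip: power_mult)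
  \<comment> \<open>This numerical inequality, \<open>(27/4) ^ 13 <= 2 ^ 36\<close>, is the source
    of the exponent \<open>12/13\<close>.\<close>
  also have "\<dots> \<le> (2 ^ 36) ^ n" by (intro power_mono) (simp_all add: divide_simps)
  also have "\<dots> = 2 ^ (12 * n * 3)" by (simp only: power_mult[symmetric]) simp
  also have "\<dots> = (2 ^ (12 * n)) ^ 3" by (rule power_mult)
  finally have "(real (card (low_degree n)) ^ 13) ^ 3 \<le> (2 ^ (12 * n)) ^ 3"
    by (simp add: mult.commute flip: power_mult)
  then show ?thesis by (rule power_mono_iff[THEN iffD1, rotated -1]) auto
qed

section \<open>Linear functionals\<close>

text \<open>A functional is encoded by its set \<open>R\<close> of coordinates. Adding a coordinate
  \<open>a\<close> to \<open>R\<close> flips its value on the vectors that are 1 at \<open>a\<close>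
  and changes nothing on the others, so one of the two choices is good on both parts.\<close>

lemma functional_nonzero_on_half:
  fixes D :: "('a \<Rightarrow>\<^sub>0 bit) set"
  assumes "finite J" "finite D" "\<And>d. d \<in> D \<Longrightarrow> \<exists>e\<in>J. Poly_Mapping.lookup d e \<noteq> 0"
  shows "\<exists>R\<subseteq>J. card D \<le> 2 * card {d\<in>D. (\<Sum>e\<in>R. Poly_Mapping.lookup d e) = 1}"
  using assms
proof (induction J arbitrary: D rule: finite_induct)
  case empty
  then have "D = {}" by blast
  then show ?case by simp
next
  case (insert a J)
  define D0 where "D0 = {d\<in>D. Poly_Mapping.lookup d a = 0}"
  define D1 where "D1 = {d\<in>D. Poly_Mapping.lookup d a = 1}"
  have D: "D = D0 \<union> D1" "D0 \<inter> D1 = {}" "finite D0" "finite D1"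
    using insert.prems by (auto simp: D0_def D1_def)
  obtain R where R: "R \<subseteq> J" "card D0 \<le> 2 * card {d\<in>D0. (\<Sum>e\<in>R. Poly_Mapping.lookup d e) = 1}"
  proof -
    have "\<exists>e\<in>J. Poly_Mapping.lookup d e \<noteq> 0" if "d \<in> D0" for d
      using insert.prems(2)[of d] that by (auto simp: D0_def)
    then show thesis using insert.IH[of D0] D(3) that by blast
  qed
  define h where "h S X = {d\<in>X. (\<Sum>e\<in>S. Poly_Mapping.lookup d e) = 1}" for S and X :: "('a \<Rightarrow>\<^sub>0 bit) set"
  have h: "card (h S D) = card (h S D0) + card (h S D1)" for S
  proof -
    have "h S D = h S D0 \<union> h S D1" using D by (auto simp: h_def)
    then show ?thesis using D by (simp add: card_Un_disjoint h_def disjoint_iff)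
  qed
  have sum_a: "(\<Sum>e\<in>insert a R. Poly_Mapping.lookup d e) = Poly_Mapping.lookup d a + (\<Sum>e\<in>R. Poly_Mapping.lookup d e)" for d
    using R insert.hyps finite_subset by (subst sum.insert) auto
  have D0: "h (insert a R) D0 = h R D0"
    by (auto simp: h_def sum_a D0_def)
  have "h (insert a R) D1 = D1 - h R D1"
    by (auto simp: h_def sum_a D1_def)
  then have "card (h (insert a R) D1) = card D1 - card (h R D1)" "card (h R D1) \<le> card D1"
    using D by (auto simp: h_def card_Diff_subset card_mono)
  then have "card D1 \<le> 2 * card (h R D1) \<or> card D1 \<le> 2 * card (h (insert a R) D1)"
    by linarith
  moreover have "card D = card D0 + card D1" using D by (simp add: card_Un_disjoint)
  ultimately have "card D \<le> 2 * card (h R D) \<or> card D \<le> 2 * card (h (insert a R) D)"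
    using R(2) D0 h[of R] h[of "insert a R"] by (auto simp: h_def)
  then show ?case using R(1) unfolding h_def by blast
qed

text \<open>Each new functional is nonzero on at least half of the vectors not yet separated, so
  \<open>n\<close> of them exhaust fewer than \<open>2 ^ n\<close> vectors.\<close>

lemma separating_functionals:
  fixes D :: "('a \<Rightarrow>\<^sub>0 bit) set"
  assumes "finite D" "0 \<notin> D" "card D < 2 ^ n"
  shows "\<exists>R. \<forall>d\<in>D. \<exists>c<n. (\<Sum>e\<in>R c. Poly_Mapping.lookup d e) \<noteq> 0"
  using assms
proof (induction n arbitrary: D)
  case 0
  then show ?case by auto
next
  case (Suc n)
  define J where "J = (\<Union>d\<in>D. Poly_Mapping.keys d)"
  have J: "finite J" using Suc.prems by (auto simp: J_def)
  have "\<exists>e\<in>J. Poly_Mapping.lookup d e \<noteq> 0" if "d \<in> D" for d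
  proof -
    have "d \<noteq> 0" using that Suc.prems by auto
    then obtain e where "Poly_Mapping.lookup d e \<noteq> 0" by (metis lookup_zero poly_mapping_eqI)
    then show ?thesis using that by (intro bexI[of _ e]) (auto simp: J_def in_keys_iff)
  qed
  then obtain S where S: "card D \<le> 2 * card {d\<in>D. (\<Sum>e\<in>S. Poly_Mapping.lookup d e) = 1}"
    using functional_nonzero_on_half[OF J Suc.prems(1)] by blast
  define D' where "D' = {d\<in>D. (\<Sum>e\<in>S. Poly_Mapping.lookup d e) = 0}"
  have "D' = D - {d\<in>D. (\<Sum>e\<in>S. Poly_Mapping.lookup d e) = 1}" by (auto simp: D'_def)
  then have "card D' = card D - card {d\<in>D. (\<Sum>e\<in>S. Poly_Mapping.lookup d e) = 1}"
    using Suc.prems(1) by (simp add: card_Diff_subset)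
  then have "card D' < 2 ^ n" using S Suc.prems(3) by simp
  then obtain R where R: "\<And>d. d \<in> D' \<Longrightarrow> \<exists>c<n. (\<Sum>e\<in>R c. Poly_Mapping.lookup d e) \<noteq> 0"
    using Suc.IH[of D'] Suc.prems by (auto simp: D'_def)
  have "\<exists>c<Suc n. (\<Sum>e\<in>(R(n := S)) c. Poly_Mapping.lookup d e) \<noteq> 0" if "d \<in> D" for d
  proof (cases "d \<in> D'")
    case True
    then obtain c where "c < n" "(\<Sum>e\<in>R c. Poly_Mapping.lookup d e) \<noteq> 0" using R by blast
    then show ?thesis by (intro exI[of _ c]) auto
  next
    case False
    then show ?thesis using that by (intro exI[of _ n]) (auto simp: D'_def)
  qed
  then show ?case by blast
qed

section \<open>Half graphs\<close>

lemma uminus_F2 [simp]: "- x = (x :: 'a \<Rightarrow>\<^sub>0 bit)"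
  by (rule poly_mapping_eqI) (simp add: lookup_uminus)

lemma add_self_F2 [simp]: "x + x = (0 :: 'a \<Rightarrow>\<^sub>0 bit)"
  by (rule poly_mapping_eqI) (simp add: lookup_add)

lemma half_graph_in_sumset:
  fixes s t :: "'i::linorder \<Rightarrow> ('a \<Rightarrow>\<^sub>0 bit)"
  assumes fin: "finite I" "finite Z" and I: "I \<noteq> {}"
    and st: "\<And>i j. i \<in> I \<Longrightarrow> j \<in> I \<Longrightarrow> s i + t j \<in> A \<longleftrightarrow> i \<le> j"
    and Z: "s ` I \<subseteq> Z" "t ` I \<subseteq> Z"
  shows "real (card I) ^ 13 \<le> 3 ^ 13 * (2 * real (card (Z + Z + Z + Z))) ^ 12"
proof -
  let ?D = "Z + Z + Z + Z"
  have fD: "finite ?D" using fin by (simp add: finite_set_plus)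
  have D: "s i + t j + (s l + t l) \<in> ?D" if "i \<in> I" "j \<in> I" "l \<in> I" for i j l
  proof -
    have "s i + t j + s l + t l \<in> ?D" using that Z by (intro set_plus_intro) auto
    then show ?thesis by (simp add: add.assoc)
  qed
  then have "?D \<noteq> {}" using I by blast
  then have "card ?D \<ge> 1" using fD by (simp add: Suc_le_eq card_gt_0_iff)
  \<comment> \<open>Rounding up to a power of two gives \<open>2 ^ n <= 2 * card ?D\<close>, which
    is the factor 2 in the bound.\<close>
  then obtain p where p: "2 ^ p \<le> card ?D" "card ?D < 2 ^ Suc p"
    using ex_power_ivl1[of 2 "card ?D"] by auto
  define n where "n = Suc p"
  have "card (?D - {0}) < 2 ^ n"
    using p(2) card_mono[OF fD, of "?D - {0}"] by (simp add: n_def)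
  then obtain R where R: "\<And>d. d \<in> ?D - {0} \<Longrightarrow> \<exists>c<n. (\<Sum>e\<in>R c. Poly_Mapping.lookup d e) \<noteq> 0"
    using separating_functionals[of "?D - {0}" n] fD by auto
  define \<phi> where "\<phi> u c = (\<Sum>e\<in>R c. Poly_Mapping.lookup u e)" for u :: "'a \<Rightarrow>\<^sub>0 bit" and c
  have add: "\<phi> (u + v) c = \<phi> u c + \<phi> v c" for u v c
    unfolding \<phi>_def lookup_add by (rule sum.distrib)
  have nz: "\<exists>c<n. \<phi> (s i) c + \<phi> (t j) c + \<phi> (s l) c + \<phi> (t l) c \<noteq> 0"
    if "i \<in> I" "j \<in> I" "l \<in> I" "s i + t j \<noteq> s l + t l" for i j l
  proof -
    have "s i + t j + (s l + t l) \<noteq> 0"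
      using that(4) by (metis eq_neg_iff_add_eq_0 uminus_F2)
    then have "\<exists>c<n. \<phi> (s i + t j + (s l + t l)) c \<noteq> 0"
      unfolding \<phi>_def using D[OF that(1-3)] by (intro R) auto
    then show ?thesis by (simp only: add add.assoc)
  qed
  have "card I \<le> 3 * card (low_degree n)"
  proof (rule triangular_sums_bound[where x = "\<lambda>i. \<phi> (s i)" and y = "\<lambda>i. \<phi> (t i)", OF fin(1)])
    fix i j l assume ijl: "i \<in> I" "j \<in> I" "l \<in> I" "j < i"
    then have "s i + t j \<notin> A" "s l + t l \<in> A" using st by auto
    then show "\<exists>c<n. \<phi> (s i) c + \<phi> (t j) c + \<phi> (s l) c + \<phi> (t l) c \<noteq> 0"
      using ijl by (intro nz) auto
  next
    fix i l assume il: "i \<in> I" "l \<in> I" "i \<noteq> l"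
    have "s i + t i \<noteq> s l + t l"
    proof
      \<comment> \<open>In characteristic two the equation can be rearranged to exchange the indices
        of \<open>t\<close>; but exactly one of \<open>s i + t l\<close> and
        \<open>s l + t i\<close> lies in \<open>A\<close>.\<close>
      assume "s i + t i = s l + t l"
      then have "s i + t l = s l + t i"
        by (metis (no_types, opaque_lifting) add.assoc add.commute add_self_F2 add.right_neutral)
      then show False using st[of i l] st[of l i] il by auto
    qed
    then show "\<exists>c<n. \<phi> (s i) c + \<phi> (t i) c + \<phi> (s l) c + \<phi> (t l) c \<noteq> 0"
      using il by (intro nz) auto
  qed
  then have "real (card I) ^ 13 \<le> (3 * real (card (low_degree n))) ^ 13"
    by (intro power_mono) linarith+
  also have "\<dots> = 3 ^ 13 * real (card (low_degree n)) ^ 13"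
    by (simp add: power_mult_distrib)
  also have "\<dots> \<le> 3 ^ 13 * 2 ^ (12 * n)"
    by (intro mult_left_mono card_low_degree) auto
  also have "(2::real) ^ (12 * n) = (2 * 2 ^ p) ^ 12"
    by (simp only: n_def mult.commute[of 12] power_mult power_Suc)
  also have "3 ^ 13 * (2 * 2 ^ p) ^ 12 \<le> 3 ^ 13 * (2 * real (card ?D)) ^ 12"
  proof -
    have "real (2 ^ p) \<le> real (card ?D)" using p(1) by (rule of_nat_mono)
    then show ?thesis by (intro mult_left_mono power_mono) auto
  qed
  finally show ?thesis .
qed

lemma half_graph_middle_third:
  fixes s t :: "nat \<Rightarrow> ('a \<Rightarrow>\<^sub>0 bit)"
  assumes fin: "finite A" and m: "m \<ge> 1"
    and st: "\<And>i j. \<lbrakk>i \<in> {1..3*m}; j \<in> {1..3*m}\<rbrakk> \<Longrightarrow> s i + t j \<in> A \<longleftrightarrow> i \<le> j"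
  shows "m \<le> card A"
    and "real (card (let Z = s ` {m<..2*m} \<union> t ` {m<..2*m} in Z + Z + Z + Z)) \<le> 
      16 * real (card A) ^ 8 / real m ^ 7"
proof -
  let ?N = "real (card A)"
  define I where "I = {m<..2*m}"
  define P where "P = s ` {1..m}"
  define Q where "Q = t ` {2*m<..3*m}"
  define Z where "Z = s ` I \<union> t ` I"
  have finPQ: "finite P" "finite Q" "finite Z" "finite (t ` I)" by (auto simp: P_def Q_def Z_def I_def)
  \<comment> \<open>Equal values of \<open>s\<close> would give equal rows of the half graph, whose
    rows are distinct.\<close>
  have inj_s: "inj_on s {1..3*m}"
  proof (rule inj_onI)
    fix i j assume i: "i \<in> {1..3*m}" and j: "j \<in> {1..3*m}" and eq: "s i = s j"
    have "s i + t j \<in> A \<longleftrightarrow> s j + t j \<in> A" "s i + t i \<in> A \<longleftrightarrow> s j + t i \<in> A"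
      by (simp_all only: eq)
    then show "i = j" unfolding st[OF i j] st[OF j i] st[OF i i] st[OF j j] by simp
  qed
  have inj_t: "inj_on t {1..3*m}"
  proof (rule inj_onI)
    fix i j assume i: "i \<in> {1..3*m}" and j: "j \<in> {1..3*m}" and eq: "t i = t j"
    have "s i + t j \<in> A \<longleftrightarrow> s i + t i \<in> A" "s j + t j \<in> A \<longleftrightarrow> s j + t i \<in> A"
      by (simp_all only: eq)
    then show "i = j" unfolding st[OF i j] st[OF j i] st[OF i i] st[OF j j] by simp
  qed
  have cP: "card P = m"
    unfolding P_def by (subst card_image[OF inj_on_subset[OF inj_s]]) auto
  have cQ: "card Q = m"
    unfolding Q_def by (subst card_image[OF inj_on_subset[OF inj_t]]) auto
  have sub: "t ` J + s ` K \<subseteq> A" if "\<And>i j. i \<in> K \<Longrightarrow> j \<in> J \<Longrightarrow> 1 \<le> i \<and> i \<le> j \<and> j \<le> 3*m" for J K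
  proof
    fix a assume "a \<in> t ` J + s ` K"
    then obtain i j where a: "a = s i + t j" and ij: "i \<in> K" "j \<in> J"
      by (auto simp: set_plus_def add.commute)
    show "a \<in> A" unfolding a using that[OF ij] by (subst st) auto
  qed
  have QP: "Q + P \<subseteq> A" and TP: "t ` I + P \<subseteq> A" and QS: "Q + s ` I \<subseteq> A"
    unfolding P_def Q_def I_def by (intro sub; simp)+
  obtain p where p: "p \<in> P" using cP m by fastforce
  have "card Q = card (Q + {p})" by (simp add: card_plus_sing)
  also have "\<dots> \<le> card A" using QP p fin by (intro card_mono) (auto simp: set_plus_def)
  finally show mN: "m \<le> card A" by (simp add: cQ)
  have "card (Q + t ` I) * m \<le> card (Q + P) * card (t ` I + P)"
  proof -
    \<comment> \<open>In characteristic two a sumset is a difference set, as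
      \<open>ruzsa_triangle\<close> requires.\<close>
    have "Q + t ` I = {p - q |p q. p \<in> Q \<and> q \<in> t ` I}"
      unfolding set_plus_def diff_conv_add_uminus uminus_F2 by blast
    then show ?thesis using ruzsa_triangle[OF finPQ(2,4,1)] cP by simp
  qed
  also have "\<dots> \<le> card A * card A"
    using QP TP fin by (intro mult_mono card_mono) auto
  finally have "real (card (Q + t ` I) * m) \<le> real (card A * card A)" by (rule of_nat_mono)
  then have QT: "real (card (Q + t ` I)) \<le> ?N ^ 2 / m"
    using m by (simp add: field_simps power2_eq_square)
  have "Q + Z = (Q + s ` I) \<union> (Q + t ` I)" by (auto simp: Z_def set_plus_def)
  then have "card (Q + Z) \<le> card (Q + s ` I) + card (Q + t ` I)" by (simp add: card_Un_le)
  moreover have "card (Q + s ` I) \<le> card A" using QS fin by (rule card_mono[rotated])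
  moreover have "?N \<le> ?N ^ 2 / m" using m mN by (simp add: field_simps power2_eq_square mult_right_mono)
  ultimately have "real (card (Q + Z)) \<le> 2 * ?N ^ 2 / m" using QT by linarith
  \<comment> \<open>Since \<open>card Q = m\<close>, this exhibits the doubling constant
    \<open>2 * ?N ^ 2 / m ^ 2\<close>.\<close>
  also have "\<dots> = 2 * ?N ^ 2 / real m ^ 2 * card Q" using m by (simp add: cQ power2_eq_square)
  finally have "real (card (Z + Z + Z + Z)) \<le> (2 * ?N ^ 2 / real m ^ 2) ^ 4 * card Q"
    using m cQ finPQ by (intro pluennecke_4) auto
  also have "\<dots> = 16 * ?N ^ 8 / real m ^ 7"
    using m by (simp add: cQ field_simps power_mult_distrib flip: power_mult) (simp add: power_numeral_reduce)
  finally show "real (card (let Z = s ` {m<..2*m} \<union> t ` {m<..2*m} in Z + Z + Z + Z)) \<le> 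
      16 * ?N ^ 8 / real m ^ 7"
    by (simp add: Z_def I_def Let_def)
qed

lemma half_graph_bound:
  fixes s t :: "nat \<Rightarrow> ('a \<Rightarrow>\<^sub>0 bit)"
  assumes fin: "finite A" and m: "m \<ge> 1"
    and st: "\<And>i j. \<lbrakk>i \<in> {1..3*m}; j \<in> {1..3*m}\<rbrakk> \<Longrightarrow> s i + t j \<in> A \<longleftrightarrow> i \<le> j"
  shows "real m \<le> 2 * real (card A) powr (96/97)"
proof -
  let ?N = "real (card A)"
  have N: "?N > 0" using half_graph_middle_third(1)[OF assms] m by simp
  define Z where "Z = s ` {m<..2*m} \<union> t ` {m<..2*m}"
  define d where "d = real (card (Z + Z + Z + Z))"
  have d: "d \<le> 16 * ?N ^ 8 / real m ^ 7"
    using half_graph_middle_third(2)[OF assms] by (simp add: d_def Z_def Let_def)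
  have "real (card {m<..2*m}) ^ 13 \<le> 3 ^ 13 * (2 * d) ^ 12"
    unfolding d_def by (rule half_graph_in_sumset[where s = s and t = t and A = A])
      (use m st in \<open>auto simp: Z_def\<close>)
  also have "\<dots> \<le> 3 ^ 13 * (2 * (16 * ?N ^ 8 / real m ^ 7)) ^ 12"
    using d by (intro mult_left_mono power_mono) (auto simp: d_def)
  also have "\<dots> = 3 ^ 13 * 2 ^ 60 * ?N ^ 96 / real m ^ 84"
    by (simp add: power_mult_distrib power_divide flip: power_mult)
  finally have "real m ^ 13 * real m ^ 84 \<le> 3 ^ 13 * 2 ^ 60 * ?N ^ 96"
    using m by (simp add: pos_le_divide_eq)
  then have "real m ^ 97 \<le> 3 ^ 13 * 2 ^ 60 * ?N ^ 96"
    by (simp flip: power_add)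
  \<comment> \<open>As \<open>3 ^ 13 <= 2 ^ 37\<close>, the constant becomes 2 after taking the 97th
    root.\<close>
  also have "\<dots> \<le> 2 ^ 97 * ?N ^ 96"
    by (intro mult_right_mono) auto
  also have "?N ^ 96 = (?N powr (96/97)) ^ 97"
    using N by (simp add: powr_power)
  finally have "real m ^ 97 \<le> (2 * ?N powr (96/97)) ^ 97"
    by (simp only: power_mult_distrib)
  then show ?thesis by (rule power_mono_iff[THEN iffD1, rotated -1]) auto
qed

theorem theorem1p3:
  "\<exists>c C :: real. c > 0 \<and> C > 0 \<and>
     (\<forall>N :: nat. N \<ge> 1 \<longrightarrow>
       (\<forall>A :: F2_inf set. finite A \<and> card A = N \<longrightarrow>
         (\<forall>k :: nat. k \<ge> 1 \<and> real k \<ge> C * real N powr (1 - c) \<longrightarrow> k_stable k A)))"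
proof (rule exI[of _ "1/97"], rule exI[of _ 11], intro conjI allI impI; (elim conjE)?)
  fix N k :: nat and A :: "F2_inf set"
  assume N: "N \<ge> 1" and A: "finite A" "card A = N" and k: "11 * real N powr (1 - 1/97) \<le> real k"
  have N1: "real N powr (96/97) \<ge> 1" using N by (intro ge_one_powr_ge_zero) auto
  show "k_stable k A"
    unfolding k_stable_def k_order_property_def
  proof (rule notI, elim exE)
    fix s t assume st: "\<forall>i\<in>{1..k}. \<forall>j\<in>{1..k}. s i + t j \<in> A \<longleftrightarrow> i \<le> j"
    define m where "m = k div 3"
    \<comment> \<open>Here \<open>k >= 11\<close>, so rounding costs little:
      \<open>k <= 3 * m + 2 <= 5 * m\<close>. The bound on \<open>m\<close> then gives
      \<open>k <= 10 * N powr (96/97)\<close>, which the constant 11 excludes.\<close>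
    have m: "m \<ge> 1" "real k \<le> 5 * real m" using k N1 by (auto simp: m_def)
    have "real m \<le> 2 * real (card A) powr (96/97)"
      using st by (intro half_graph_bound[OF A(1) m(1), of s t]) (auto simp: m_def)
    then show False using k m N1 A by simp
  qed
qed auto

end
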